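(* Let $(X,\tau,\|\cdot\|)$ satisfy Condition B and let $\{T(t)\}_{t\ge0}$ be a locally equi-continuous semigroup on $(X,\tau)$. Then there exist $M\ge 1$ and $\omega\in\mathbb R$ such that for every $S\ge 0$ and every $p\in\mathcal N$ there is a $q\in\mathcal N$ such that for all $x\in X$ $$\sup_{0\le t\le S} e^{-\omega t}p(T(t)x)\le M q(x).$$
   Context: Condition B: $(X,\tau)$ is a locally convex space that is also equipped with a norm $\|\cdot\|$ such that (a) $\tau$ is weaker than the norm topology, and (b) $\tau$ and the norm topology have the same bounded sets. $\mathcal N$ denotes the set of $\tau$-continuous semi-norms $p$ on $X$ with $p(x)\le\|x\|$ for all $x\in X$. A semigroup is a family of linear operators with $T(0)=\mathrm{Id}$ and $T(t)T(s)=T(t+s)$ for $s,t\ge0$. It is locally equi-continuous if for every $t\ge 0$ and every $\tau$-continuous semi-norm $p$ there exists a $\tau$-continuous semi-norm $q$ such that $\sup_{s\le t}p(T(s)x)\le q(x)$ for every $x\in X$. *)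

theory Defs
  imports "HOL-Analysis.Analysis"
begin

(* The scalar field is any 'k :: real_normed_field. Since the norm of such a field is
   multiplicative, it is isometrically isomorphic to the reals or to the complex numbers
   (Gelfand-Mazur), so this covers exactly the real and the complex case. The real vector space
   structure on 'a is the restriction of smul to real scalars; it makes the library's convex
   and norm available. *)

locale topological_vector_space = vector_space smul
  for smul :: "'k::real_normed_field \<Rightarrow> 'a::real_vector \<Rightarrow> 'a" +
  fixes \<tau> :: "'a topology"
  assumes smul_of_real: "smul (of_real r) x = r *\<^sub>R x"
    and topspace_UNIV: "topspace \<tau> = UNIV"
    and continuous_add: "continuous_map (prod_topology \<tau> \<tau>) \<tau> (\<lambda>(x, y). x + y)"
    and continuous_smul: "continuous_map (prod_topology euclidean \<tau>) \<tau> (\<lambda>(c, x). smul c x)"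

(* Hausdorff is not required here; it follows once the bounded sets of the topology are
   those of a norm. *)
locale locally_convex_space = topological_vector_space smul \<tau>
  for smul :: "'k::real_normed_field \<Rightarrow> 'a::real_vector \<Rightarrow> 'a" and \<tau> +
  assumes convex_base:
    "openin \<tau> U \<Longrightarrow> 0 \<in> U \<Longrightarrow> \<exists>V. openin \<tau> V \<and> 0 \<in> V \<and> convex V \<and> V \<subseteq> U"

text \<open>Von Neumann boundedness: the set is absorbed by every neighbourhood of the origin.\<close>

definition tvs_bounded :: "'a::real_vector topology \<Rightarrow> 'a set \<Rightarrow> bool" where
  "tvs_bounded \<tau> B \<longleftrightarrow>
     (\<forall>U. openin \<tau> U \<longrightarrow> 0 \<in> U \<longrightarrow> (\<exists>s>0. \<forall>t>s. B \<subseteq> (\<lambda>x. t *\<^sub>R x) ` U))"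

locale condition_B = locally_convex_space smul \<tau>
  for smul :: "'k::real_normed_field \<Rightarrow> 'a::real_normed_vector \<Rightarrow> 'a" and \<tau> +
  assumes norm_smul: "norm (smul c x) = norm c * norm x"
    and weaker_than_norm: "openin \<tau> U \<Longrightarrow> open U"
    and same_bounded_sets: "tvs_bounded \<tau> B \<longleftrightarrow> bounded B"

definition seminorm :: "('k::real_normed_field \<Rightarrow> 'a::ab_group_add \<Rightarrow> 'a) \<Rightarrow> ('a \<Rightarrow> real) \<Rightarrow> bool"
  where "seminorm smul p \<longleftrightarrow>
     (\<forall>x. 0 \<le> p x) \<and>
     (\<forall>x y. p (x + y) \<le> p x + p y) \<and>
     (\<forall>c x. p (smul c x) = norm c * p x)"

definition continuous_seminorms ::
  "('k::real_normed_field \<Rightarrow> 'a::ab_group_add \<Rightarrow> 'a) \<Rightarrow> 'a topology \<Rightarrow> ('a \<Rightarrow> real) set"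
  where "continuous_seminorms smul \<tau> =
     {p. seminorm smul p \<and> continuous_map \<tau> euclideanreal p}"

definition norm_dominated_seminorms ::
  "('k::real_normed_field \<Rightarrow> 'a::real_normed_vector \<Rightarrow> 'a) \<Rightarrow> 'a topology \<Rightarrow> ('a \<Rightarrow> real) set"
  (\<open>\<N>\<close>)
  where "\<N> smul \<tau> = {p \<in> continuous_seminorms smul \<tau>. \<forall>x. p x \<le> norm x}"

(* Time is modelled by the type real; the values of T at negative times are irrelevant. *)
definition operator_semigroup ::
  "('k::real_normed_field \<Rightarrow> 'a::ab_group_add \<Rightarrow> 'a) \<Rightarrow> (real \<Rightarrow> 'a \<Rightarrow> 'a) \<Rightarrow> bool"
  where "operator_semigroup smul T \<longleftrightarrow>
     (\<forall>t\<ge>0. Vector_Spaces.linear smul smul (T t)) \<and>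
     T 0 = id \<and>
     (\<forall>s\<ge>0. \<forall>t\<ge>0. T t \<circ> T s = T (t + s))"

(* The supremum is taken in the extended reals, so that the bound includes its finiteness. *)
definition locally_equicontinuous ::
  "('k::real_normed_field \<Rightarrow> 'a::ab_group_add \<Rightarrow> 'a) \<Rightarrow> 'a topology \<Rightarrow> (real \<Rightarrow> 'a \<Rightarrow> 'a) \<Rightarrow> bool"
  where "locally_equicontinuous smul \<tau> T \<longleftrightarrow>
     (\<forall>t\<ge>0. \<forall>p\<in>continuous_seminorms smul \<tau>. \<exists>q\<in>continuous_seminorms smul \<tau>.
        \<forall>x. (SUP s\<in>{0..t}. ereal (p (T s x))) \<le> ereal (q x))"

end

theory Submission
  imports Defs
begin

text \<open>The norm unit ball is bounded for the topology, so by local equicontinuity its image under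
  all \<open>T s\<close> with \<open>s \<le> 1\<close> is bounded for the topology, hence for the norm. The semigroup law turns
  this into \<open>norm (T t x) \<le> M * exp (\<omega> * t) * norm x\<close>. Therefore the supremum of
  \<open>exp (- \<omega> * t) * p (T t x) / M\<close> over \<open>t\<close> in \<open>{0..S}\<close> is dominated by the norm, and it is a
  continuous seminorm because a continuous seminorm dominates it: it can serve as \<open>q\<close>.\<close>

section \<open>Seminorms and their continuity in a topological vector space\<close>

lemma
  assumes "seminorm smul p"
  shows seminorm_nonneg: "0 \<le> p x"
    and seminorm_triangle: "p (x + y) \<le> p x + p y"
    and seminorm_smul: "p (smul c x) = norm c * p x"
  using assms by (auto simp: seminorm_def)

lemma locally_equicontinuousE:
  assumes "locally_equicontinuous smul \<tau> T" "0 \<le> S" "p \<in> continuous_seminorms smul \<tau>"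
  obtains q where "q \<in> continuous_seminorms smul \<tau>"
    "\<And>t x. 0 \<le> t \<Longrightarrow> t \<le> S \<Longrightarrow> p (T t x) \<le> q x"
proof -
  obtain q where q: "q \<in> continuous_seminorms smul \<tau>"
    and le: "\<And>x. (SUP s\<in>{0..S}. ereal (p (T s x))) \<le> ereal (q x)"
    using assms unfolding locally_equicontinuous_def by blast
  have "p (T t x) \<le> q x" if "0 \<le> t" "t \<le> S" for t x
    using le[of x] that by (auto simp: SUP_le_iff)
  with q show thesis by (rule that)
qed

context topological_vector_space
begin

lemma smul_scaleR: "smul c (r *\<^sub>R x) = r *\<^sub>R smul c x"
  by (metis scale_left_commute smul_of_real)

lemma seminorm_scaleR:
  assumes "seminorm smul p"
  shows "p (r *\<^sub>R x) = \<bar>r\<bar> * p x"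
  using seminorm_smul[OF assms, of "of_real r" x] by (simp add: smul_of_real)

lemma seminorm_diff:
  assumes "seminorm smul p"
  shows "\<bar>p x - p y\<bar> \<le> p (x - y)"
proof -
  have "p (y - x) = p (x - y)"
    using seminorm_scaleR[OF assms, of "-1" "x - y"] by simp
  then show ?thesis
    using seminorm_triangle[OF assms, of "x - y" y] seminorm_triangle[OF assms, of "y - x" x]
    by simp
qed

text \<open>Applying \<open>le\<close> to \<open>inverse c\<close> and \<open>smul c x\<close> gives
  the reverse inequality, so homogeneity needs only one direction. For infima and suprema, as for
  the Minkowski functional and the supremum over time below, that direction is the one that comes
  directly.\<close>

lemma seminormI:
  assumes nonneg: "\<And>x. 0 \<le> p x" and triangle: "\<And>x y. p (x + y) \<le> p x + p y"
    and le: "\<And>c x. p (smul c x) \<le> norm c * p x"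
  shows "seminorm smul p"
proof -
  have "p (smul c x) = norm c * p x" for c x
  proof (cases "c = 0")
    case True
    then show ?thesis using le[of c x] nonneg[of "smul c x"] by simp
  next
    case False
    then have "p x \<le> inverse (norm c) * p (smul c x)"
      using le[of "inverse c" "smul c x"] by (simp add: norm_inverse)
    then have "norm c * p x \<le> p (smul c x)" using False by (simp add: field_simps)
    with le show ?thesis by (rule antisym)
  qed
  with nonneg triangle show ?thesis by (simp add: seminorm_def)
qed

lemma continuous_map_smul_const: "continuous_map \<tau> \<tau> (smul c)"
proof -
  have "continuous_map \<tau> (prod_topology euclidean \<tau>) (\<lambda>x. (c, x))"
    by (simp add: continuous_map_paired)
  from continuous_map_compose[OF this continuous_smul] show ?thesis
    by (simp add: o_def)
qed

lemma continuous_map_add_const: "continuous_map \<tau> \<tau> (\<lambda>x. x + a)"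
proof -
  have "continuous_map \<tau> (prod_topology \<tau> \<tau>) (\<lambda>x. (x, a))"
    by (simp add: continuous_map_paired topspace_UNIV)
  from continuous_map_compose[OF this continuous_add] show ?thesis
    by (simp add: o_def)
qed

lemma openin_scale_diff:
  assumes "openin \<tau> V"
  shows "openin \<tau> {y. r *\<^sub>R (y - x) \<in> V}"
proof -
  have "continuous_map \<tau> \<tau> (\<lambda>y. r *\<^sub>R (y - x))"
    using continuous_map_compose[OF continuous_map_add_const[of "- x"]
        continuous_map_smul_const[of "of_real r"]]
    by (simp add: o_def smul_of_real)
  from openin_continuous_map_preimage[OF this assms] show ?thesis
    by (simp add: topspace_UNIV)
qed

text \<open>Translation and scaling carry \<open>V\<close> to a neighbourhood of any
  \<open>x\<close>: if \<open>y - x\<close> lies in \<open>V\<close> scaled by \<open>e / 2\<close>,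
  then \<open>p (y - x)\<close> is at most \<open>e / 2\<close>, and the reverse triangle inequality
  keeps \<open>p y\<close> within \<open>e\<close> of \<open>p x\<close>.\<close>

lemma continuous_seminorm_if_bounded:
  assumes p: "seminorm smul p" and V: "openin \<tau> V" "0 \<in> V" and le: "\<And>x. x \<in> V \<Longrightarrow> p x \<le> 1"
  shows "p \<in> continuous_seminorms smul \<tau>"
proof -
  have "openin \<tau> {x. p x \<in> U}" if "open U" for U
  proof (subst openin_subopen, safe)
    fix x assume "p x \<in> U"
    then obtain e where e: "e > 0" "ball (p x) e \<subseteq> U"
      using \<open>open U\<close> openE by blast
    have "p y \<in> U" if "(2 / e) *\<^sub>R (y - x) \<in> V" for y
    proof -
      have "(2 / e) * p (y - x) \<le> 1"
        using le[OF that] e by (simp add: seminorm_scaleR[OF p])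
      then have "p (y - x) < e" using e by (simp add: field_simps)
      then have "\<bar>p y - p x\<bar> < e" using seminorm_diff[OF p, of y x] by linarith
      then show ?thesis using e by (auto simp: dist_real_def)
    qed
    then show "\<exists>W. openin \<tau> W \<and> x \<in> W \<and> W \<subseteq> {x. p x \<in> U}"
      using openin_scale_diff[OF V(1), of "2 / e" x] V(2)
      by (intro exI[of _ "{y. (2 / e) *\<^sub>R (y - x) \<in> V}"]) auto
  qed
  then show ?thesis
    using p by (simp add: continuous_seminorms_def continuous_map_def topspace_UNIV)
qed

lemma openin_seminorm_less:
  assumes "p \<in> continuous_seminorms smul \<tau>"
  shows "openin \<tau> {x. p x < r}"
  using openin_continuous_map_preimage[of \<tau> euclideanreal p "{..<r}"] assms
  by (simp add: continuous_seminorms_def topspace_UNIV)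

text \<open>The open unit ball of \<open>q\<close> is a neighbourhood of the origin on which
  \<open>p\<close> is at most 1. This makes a supremum of infinitely many seminorms continuous as
  soon as one continuous seminorm dominates them all.\<close>

lemma continuous_seminorm_dominated:
  assumes "seminorm smul p" and q: "q \<in> continuous_seminorms smul \<tau>" and "\<And>x. p x \<le> q x"
  shows "p \<in> continuous_seminorms smul \<tau>"
proof (rule continuous_seminorm_if_bounded)
  show "openin \<tau> {x. q x < 1}" by (rule openin_seminorm_less[OF q])
  have "seminorm smul q" using q by (simp add: continuous_seminorms_def)
  from seminorm_scaleR[OF this, of 0 0] show "0 \<in> {x. q x < 1}" by simp
  show "p x \<le> 1" if "x \<in> {x. q x < 1}" for x
    using assms(3)[of x] that by auto
qed fact

text \<open>Joint continuity of scalar multiplication at \<open>(0, 0)\<close> gives a disc of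
  radius \<open>d\<close> and a neighbourhood whose product is mapped into \<open>U\<close>.
  Shrinking the neighbourhood by the factor \<open>d / 2\<close> allows all scalars of the closed
  unit disc.\<close>

lemma balanced_core_neighbourhood:
  assumes U: "openin \<tau> U" "0 \<in> U"
  obtains V where "openin \<tau> V" "0 \<in> V" "\<And>x c. x \<in> V \<Longrightarrow> norm c \<le> 1 \<Longrightarrow> smul c x \<in> U"
proof -
  let ?P = "{z. smul (fst z) (snd z) \<in> U}"
  have "openin (prod_topology euclidean \<tau>) ?P"
    using openin_continuous_map_preimage[OF continuous_smul U(1)]
    by (simp add: topspace_UNIV split_beta)
  moreover have "(0, 0) \<in> ?P" using U by simp
  ultimately have "\<exists>D V. openin euclidean D \<and> openin \<tau> V \<and> 0 \<in> D \<and> 0 \<in> V \<and> D \<times> V \<subseteq> ?P"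
    unfolding openin_prod_topology_alt by (elim allE[of _ 0] impE)
  then obtain D V where DV: "open D" "openin \<tau> V" "0 \<in> D" "0 \<in> V" "D \<times> V \<subseteq> ?P"
    unfolding open_openin[symmetric] by (elim exE conjE)
  then obtain d where d: "d > 0" "ball 0 d \<subseteq> D" using openE by blast
  show thesis
  proof
    show "openin \<tau> {x. (2 / d) *\<^sub>R (x - 0) \<in> V}" by (rule openin_scale_diff) fact
    show "0 \<in> {x. (2 / d) *\<^sub>R (x - 0) \<in> V}" using DV by simp
    show "smul c x \<in> U" if "x \<in> {x. (2 / d) *\<^sub>R (x - 0) \<in> V}" "norm c \<le> 1" for x c
    proof -
      have "norm (of_real (d / 2) * c) < d"
        using that(2) d mult_left_le[of "norm c" d] by (simp add: norm_mult)
      then have "of_real (d / 2) * c \<in> D" using d by auto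
      then have "smul (of_real (d / 2) * c) ((2 / d) *\<^sub>R x) \<in> U" using DV that(1) by auto
      moreover have "smul (of_real (d / 2) * c) ((2 / d) *\<^sub>R x) = smul c x"
        using d by (simp only: scale_scale[symmetric] smul_scaleR smul_of_real) simp
      ultimately show ?thesis by simp
    qed
  qed
qed

end

section \<open>Minkowski functionals and the neighbourhoods of a locally convex topology\<close>

definition minkowski_functional :: "'a::real_vector set \<Rightarrow> 'a \<Rightarrow> real" where
  "minkowski_functional W x = Inf {r. 0 < r \<and> inverse r *\<^sub>R x \<in> W}"

lemma minkowski_functional_le:
  "0 < r \<Longrightarrow> inverse r *\<^sub>R x \<in> W \<Longrightarrow> minkowski_functional W x \<le> r"
  unfolding minkowski_functional_def by (rule cInf_lower) (auto intro: bdd_belowI[of _ 0])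

text \<open>Absorption keeps the set under \<open>Inf\<close> nonempty; the infimum of an empty set
  of reals carries no information.\<close>

lemma minkowski_functional_less_iff:
  assumes "\<And>x. \<exists>r>0. inverse r *\<^sub>R x \<in> W"
  shows "minkowski_functional W x < s \<longleftrightarrow> (\<exists>r>0. r < s \<and> inverse r *\<^sub>R x \<in> W)"
proof -
  have "{r. 0 < r \<and> inverse r *\<^sub>R x \<in> W} \<noteq> {}" using assms[of x] by auto
  then show ?thesis
    unfolding minkowski_functional_def by (subst cInf_less_iff) (auto intro: bdd_belowI[of _ 0])
qed

context topological_vector_space
begin

text \<open>Convexity yields the triangle inequality, balancedness the homogeneity for scalars in
  \<open>'k\<close>. The infimum may fail to be attained, so both arguments take nearly optimal
  radii and leave an arbitrarily small error.\<close>

lemma seminorm_minkowski_functional: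
  assumes absorbing: "\<And>x. \<exists>r>0. inverse r *\<^sub>R x \<in> W" and "convex W"
    and balanced: "\<And>c x. x \<in> W \<Longrightarrow> norm c \<le> 1 \<Longrightarrow> smul c x \<in> W"
  shows "seminorm smul (minkowski_functional W)"
proof -
  let ?p = "minkowski_functional W"
  note lessD = minkowski_functional_less_iff[THEN iffD1, OF absorbing]
  have nonneg: "0 \<le> ?p x" for x
    unfolding minkowski_functional_def using absorbing[of x] by (intro cInf_greatest) auto
  have triangle: "?p (x + y) \<le> ?p x + ?p y" for x y
  proof (rule field_le_epsilon)
    fix e :: real assume "e > 0"
    obtain r where r: "r > 0" "r < ?p x + e / 2" "inverse r *\<^sub>R x \<in> W"
      using lessD[of x "?p x + e / 2"] \<open>e > 0\<close> by auto
    obtain s where s: "s > 0" "s < ?p y + e / 2" "inverse s *\<^sub>R y \<in> W"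
      using lessD[of y "?p y + e / 2"] \<open>e > 0\<close> by auto
    \<comment> \<open>The weights are chosen so that the convex combination of x/r and y/s equals (x
      + y)/(r + s).\<close>
    have "(r / (r + s)) *\<^sub>R inverse r *\<^sub>R x + (s / (r + s)) *\<^sub>R inverse s *\<^sub>R y \<in> W"
      using r s by (intro convexD[OF \<open>convex W\<close>]) (auto simp: add_divide_distrib[symmetric])
    moreover have "(r / (r + s)) *\<^sub>R inverse r *\<^sub>R x + (s / (r + s)) *\<^sub>R inverse s *\<^sub>R y
      = inverse (r + s) *\<^sub>R (x + y)"
      using r s by (simp add: scaleR_add_right inverse_eq_divide)
    ultimately have "?p (x + y) \<le> r + s"
      using r s by (intro minkowski_functional_le) auto
    then show "?p (x + y) \<le> ?p x + ?p y + e" using r s by linarith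
  qed
  have le: "?p (smul c x) \<le> norm c * ?p x" for c x
  proof (rule field_le_epsilon)
    fix e :: real assume e: "e > 0"
    \<comment> \<open>With this \<open>d\<close>, the error \<open>norm c * d\<close> stays below
      \<open>e\<close>; the added 1 keeps the denominator positive when
      \<open>c = 0\<close>.\<close>
    define d where "d = e / (norm c + 1)"
    have nc: "norm c + 1 > 0" by (simp add: add_nonneg_pos)
    then have d: "d > 0" using e by (simp add: d_def)
    obtain r where r: "r > 0" "r < ?p x + d" "inverse r *\<^sub>R x \<in> W"
      using lessD[of x "?p x + d"] d by auto
    \<comment> \<open>A positive \<open>s\<close> stands in for \<open>norm c\<close>, which may
      vanish. The scalar c/s has norm at most 1, so balancedness keeps its product with x/r in
      \<open>W\<close>. Letting \<open>s\<close> decrease to \<open>norm c\<close> then gives the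
      bound.\<close>
    have bound: "?p (smul c x) \<le> s * r" if "s > 0" "norm c \<le> s" for s
    proof (rule minkowski_functional_le)
      have "inverse s * norm c \<le> 1" using that by (simp add: field_simps)
      then have "norm (of_real (inverse s) * c) \<le> 1"
        using that by (simp add: norm_mult norm_inverse)
      with r(3) have "smul (of_real (inverse s) * c) (inverse r *\<^sub>R x) \<in> W"
        by (rule balanced)
      then show "inverse (s * r) *\<^sub>R smul c x \<in> W"
        by (simp only: scale_scale[symmetric] smul_scaleR smul_of_real) (simp add: mult.commute)
    qed (use that r in auto)
    have "?p (smul c x) \<le> norm c * r"
    proof (rule field_le_epsilon)
      fix e' :: real assume e': "e' > 0"
      have "?p (smul c x) \<le> (norm c + e' / r) * r"
        using e' r by (intro bound) (auto intro: add_nonneg_pos)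
      then show "?p (smul c x) \<le> norm c * r + e'"
        using r by (simp add: distrib_right)
    qed
    also have "\<dots> \<le> norm c * (?p x + d)" using r by (intro mult_left_mono) auto
    also have "\<dots> \<le> norm c * ?p x + e"
      using e nc by (simp add: d_def field_simps)
    finally show "?p (smul c x) \<le> norm c * ?p x + e" .
  qed
  from nonneg triangle le show ?thesis by (rule seminormI)
qed

end

text \<open>The seminorm is the Minkowski functional of a convex balanced set inside
  \<open>U\<close>. The lemma allows absorption by neighbourhoods to be checked with seminorms, the
  form in which local equicontinuity is stated.\<close>

lemma (in locally_convex_space) continuous_seminorm_neighbourhood:
  assumes "openin \<tau> U" "0 \<in> U"
  obtains p where "p \<in> continuous_seminorms smul \<tau>" "\<And>x. p x < 1 \<Longrightarrow> x \<in> U"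
proof -
  obtain C where C: "openin \<tau> C" "0 \<in> C" "convex C" "C \<subseteq> U"
    using convex_base[OF assms] by blast
  obtain V where V: "openin \<tau> V" "0 \<in> V" "\<And>x c. x \<in> V \<Longrightarrow> norm c \<le> 1 \<Longrightarrow> smul c x \<in> C"
    using balanced_core_neighbourhood[OF C(1,2)] by blast
  \<comment> \<open>\<open>W\<close> is the largest balanced subset of \<open>C\<close>. It inherits
    convexity from \<open>C\<close>, and it contains the open set \<open>V\<close>, which is enough
    for its functional to be continuous.\<close>
  define W where "W = {x. \<forall>c. norm c \<le> 1 \<longrightarrow> smul c x \<in> C}"
  have VW: "V \<subseteq> W" using V by (auto simp: W_def)
  have balanced: "smul c x \<in> W" if "x \<in> W" "norm c \<le> 1" for c x
    using that by (auto simp: W_def norm_mult mult_le_one)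
  have convex: "convex W"
    using convexD[OF C(3)]
    by (auto simp: convex_def W_def scale_right_distrib smul_scaleR)
  have absorbing: "\<exists>r>0. inverse r *\<^sub>R x \<in> W" for x
  proof -
    \<comment> \<open>Since \<open>r *\<^sub>R x\<close> depends continuously on \<open>r\<close>,
      all small multiples of \<open>x\<close> lie in \<open>V\<close> and hence in
      \<open>W\<close>.\<close>
    have "continuous_map euclideanreal (prod_topology euclidean \<tau>) (\<lambda>r. (of_real r :: 'k, x))"
      by (simp add: continuous_map_paired topspace_UNIV linear_continuous_on bounded_linear_of_real)
    from continuous_map_compose[OF this continuous_smul]
    have "continuous_map euclideanreal \<tau> (\<lambda>r. r *\<^sub>R x)" by (simp add: o_def smul_of_real)
    from openin_continuous_map_preimage[OF this V(1)] have "open {r. r *\<^sub>R x \<in> V}" by simp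
    then obtain e where e: "e > 0" "ball 0 e \<subseteq> {r. r *\<^sub>R x \<in> V}"
      using V(2) openE[of "{r. r *\<^sub>R x \<in> V}" 0] by auto
    then have "e / 2 \<in> {r. r *\<^sub>R x \<in> V}" by (intro subsetD[OF e(2)]) auto
    then show ?thesis using e VW by (intro exI[of _ "inverse (e / 2)"]) auto
  qed
  show thesis
  proof
    show "minkowski_functional W \<in> continuous_seminorms smul \<tau>"
    proof (rule continuous_seminorm_if_bounded[OF seminorm_minkowski_functional V(1,2)])
      show "minkowski_functional W x \<le> 1" if "x \<in> V" for x
        using minkowski_functional_le[of 1 x W] that VW by auto
    qed (use absorbing convex balanced in auto)
    show "x \<in> U" if less: "minkowski_functional W x < 1" for x
    proof -
      obtain r where r: "r > 0" "r < 1" "inverse r *\<^sub>R x \<in> W"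
        using minkowski_functional_less_iff[THEN iffD1, OF absorbing less] by blast
      then have "smul (of_real r) (inverse r *\<^sub>R x) \<in> C" by (auto simp: W_def)
      then show ?thesis using r C by (auto simp: smul_of_real)
    qed
  qed
qed

section \<open>Norm estimates for the semigroup\<close>

lemma (in condition_B) locally_equicontinuous_norm_bounded:
  assumes "\<And>t. 0 \<le> t \<Longrightarrow> Vector_Spaces.linear smul smul (T t)"
    and T: "locally_equicontinuous smul \<tau> T" and "0 \<le> S"
  obtains M where "1 \<le> M" "\<And>t x. 0 \<le> t \<Longrightarrow> t \<le> S \<Longrightarrow> norm (T t x) \<le> M * norm x"
proof -
  let ?A = "{T t x |t x. 0 \<le> t \<and> t \<le> S \<and> norm x \<le> 1}"
  have "tvs_bounded \<tau> ?A"
    unfolding tvs_bounded_def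
  proof (intro allI impI)
    fix U assume "openin \<tau> U" "0 \<in> U"
    then obtain p where p: "p \<in> continuous_seminorms smul \<tau>" "\<And>x. p x < 1 \<Longrightarrow> x \<in> U"
      using continuous_seminorm_neighbourhood by blast
    obtain q where q: "q \<in> continuous_seminorms smul \<tau>"
      and pq: "\<And>t x. 0 \<le> t \<Longrightarrow> t \<le> S \<Longrightarrow> p (T t x) \<le> q x"
      using locally_equicontinuousE[OF T \<open>0 \<le> S\<close> p(1)] by blast
    have sp: "seminorm smul p" and sq: "seminorm smul q"
      using p q by (auto simp: continuous_seminorms_def)
    \<comment> \<open>One direction of \<open>same_bounded_sets\<close>: the norm ball is absorbed
      by the unit ball of \<open>q\<close>. By \<open>pq\<close>, the same radius \<open>s\<close>
      works for \<open>?A\<close> and \<open>U\<close>.\<close>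
    have "tvs_bounded \<tau> (cball 0 1)" by (simp add: same_bounded_sets)
    moreover have "0 \<in> {x. q x < 1}" using seminorm_scaleR[OF sq, of 0 0] by simp
    ultimately obtain s where s: "s > 0"
      "\<forall>t>s. cball 0 1 \<subseteq> (\<lambda>x. t *\<^sub>R x) ` {x. q x < 1}"
      using openin_seminorm_less[OF q] unfolding tvs_bounded_def by blast
    show "\<exists>s>0. \<forall>t>s. ?A \<subseteq> (\<lambda>x. t *\<^sub>R x) ` U"
    proof (intro exI[of _ s] conjI allI impI subsetI)
      fix r y assume r: "s < r" and "y \<in> ?A"
      then obtain t x where y: "y = T t x" "0 \<le> t" "t \<le> S" "norm x \<le> 1" by blast
      then have "x \<in> (\<lambda>x. r *\<^sub>R x) ` {x. q x < 1}"
        using subsetD[OF s(2)[rule_format, OF r], of x] by simp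
      then have "q x < r" using s r by (auto simp: seminorm_scaleR[OF sq])
      then have "p y < r" using pq[of t x] y by simp
      then have "inverse r *\<^sub>R y \<in> U"
        using s r by (intro p(2)) (simp add: seminorm_scaleR[OF sp] field_simps)
      then show "y \<in> (\<lambda>x. r *\<^sub>R x) ` U"
        using s r by (intro image_eqI[of _ _ "inverse r *\<^sub>R y"]) auto
    qed fact
  qed
  \<comment> \<open>The other direction of \<open>same_bounded_sets\<close> returns from the
    topology to the norm.\<close>
  then have "bounded ?A" by (simp add: same_bounded_sets)
  then obtain M where M: "\<And>y. y \<in> ?A \<Longrightarrow> norm y \<le> M" by (auto simp: bounded_iff)
  show thesis
  proof
    fix t x assume t: "0 \<le> t" "t \<le> S"
    have scale: "T t (r *\<^sub>R y) = r *\<^sub>R T t y" for r y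
      using assms(1)[OF t(1)] module_hom.scale[of smul smul "T t" "of_real r" y]
      by (simp add: Vector_Spaces.linear_def smul_of_real)
    \<comment> \<open>The maximum with 1 secures \<open>1 \<le> M\<close>, which later makes
      \<open>ln M\<close> a nonnegative growth rate.\<close>
    show "norm (T t x) \<le> max 1 M * norm x"
    proof (cases "x = 0")
      case True
      then show ?thesis using scale[of 0 0] by simp
    next
      case False
      then have "norm (inverse (norm x) *\<^sub>R x) \<le> 1" by simp
      then have "norm (T t (inverse (norm x) *\<^sub>R x)) \<le> M" using t by (intro M) blast
      then have "norm (T t x) \<le> M * norm x" using False by (simp add: scale field_simps)
      also have "\<dots> \<le> max 1 M * norm x" by (intro mult_right_mono) auto
      finally show ?thesis .
    qed
  qed simp
qed

text \<open>Split \<open>t\<close> into its integer part \<open>n\<close> and a remainder in [0, 1].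
  Each unit step costs a factor \<open>M\<close> and the remainder one more. As \<open>M\<close> is
  at least 1, \<open>M ^ n\<close> is at most \<open>exp (ln M * t)\<close>.\<close>

lemma semigroup_exp_growth:
  fixes T :: "real \<Rightarrow> 'a::real_normed_vector \<Rightarrow> 'a"
  assumes semi: "\<And>s t. 0 \<le> s \<Longrightarrow> 0 \<le> t \<Longrightarrow> T t \<circ> T s = T (t + s)"
    and M: "1 \<le> M" and le: "\<And>t x. 0 \<le> t \<Longrightarrow> t \<le> 1 \<Longrightarrow> norm (T t x) \<le> M * norm x"
    and "0 \<le> t"
  shows "norm (T t x) \<le> M * exp (ln M * t) * norm x"
proof -
  have *: "norm (T (real n + r) x) \<le> M * M ^ n * norm x" if "0 \<le> r" "r \<le> 1" for n r x
  proof (induction n)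
    case 0
    show ?case using le that by simp
  next
    case (Suc n)
    have "T (real (Suc n) + r) x = T 1 (T (real n + r) x)"
      using semi[of "real n + r" 1] that by (simp add: fun_eq_iff add_ac)
    also have "norm \<dots> \<le> M * norm (T (real n + r) x)" by (rule le) auto
    also have "\<dots> \<le> M * (M * M ^ n * norm x)" using Suc M by (intro mult_left_mono) auto
    finally show ?case by (simp add: mult_ac)
  qed
  define n where "n = nat \<lfloor>t\<rfloor>"
  have n: "real n \<le> t" "t \<le> real n + 1" using \<open>0 \<le> t\<close> unfolding n_def by linarith+
  have "norm (T t x) \<le> M * M ^ n * norm x" using *[of "t - real n" n x] n by simp
  also have "M ^ n = exp (ln M * real n)"
    using M by (metis exp_ln exp_of_nat2_mult less_le_trans zero_less_one)
  also have "\<dots> \<le> exp (ln M * t)" using n M by (simp add: mult_left_mono)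
  finally show ?thesis using M by (simp add: mult_left_mono mult_right_mono)
qed

section \<open>The damped supremum as a dominating seminorm\<close>

theorem corollary4p7:
  fixes smul :: "'k::real_normed_field \<Rightarrow> 'a::real_normed_vector \<Rightarrow> 'a"
    and \<tau> :: "'a topology"
    and T :: "real \<Rightarrow> 'a \<Rightarrow> 'a"
  assumes "condition_B smul \<tau>"
    and "operator_semigroup smul T"
    and "locally_equicontinuous smul \<tau> T"
  shows "\<exists>M::real. \<exists>\<omega>::real. M \<ge> 1 \<and>
    (\<forall>S\<ge>0. \<forall>p\<in>\<N> smul \<tau>. \<exists>q\<in>\<N> smul \<tau>.
      \<forall>x. (SUP t\<in>{0..S}. ereal (exp (- \<omega> * t) * p (T t x))) \<le> ereal (M * q x))"
proof -
  interpret condition_B smul \<tau> by fact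
  have lin: "Vector_Spaces.linear smul smul (T t)" if "0 \<le> t" for t
    using assms(2) that by (simp add: operator_semigroup_def)
  have semi: "T t \<circ> T s = T (t + s)" if "0 \<le> s" "0 \<le> t" for s t
    using assms(2) that by (simp add: operator_semigroup_def)
  have add: "T t (x + y) = T t x + T t y" if "0 \<le> t" for t x y
    using lin[OF that] module_hom.add[of smul smul "T t" x y]
    by (simp add: Vector_Spaces.linear_def)
  have scale: "T t (smul c x) = smul c (T t x)" if "0 \<le> t" for t c x
    using lin[OF that] module_hom.scale[of smul smul "T t" c x]
    by (simp add: Vector_Spaces.linear_def)
  \<comment> \<open>Only the time interval [0, 1] enters here, so \<open>M\<close> and the rate
    \<open>\<omega>\<close> derived from it are independent of \<open>S\<close> and
    \<open>p\<close>.\<close>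
  obtain M where M: "1 \<le> M" and le: "\<And>t x. 0 \<le> t \<Longrightarrow> t \<le> 1 \<Longrightarrow> norm (T t x) \<le> M * norm x"
    using locally_equicontinuous_norm_bounded[OF lin assms(3), of 1] by auto
  define \<omega> where "\<omega> = ln M"
  have \<omega>: "0 \<le> \<omega>" using M by (simp add: \<omega>_def)
  have growth: "exp (- \<omega> * t) * norm (T t x) \<le> M * norm x" if "0 \<le> t" for t x
    using semigroup_exp_growth[of T, OF semi M le that, of x]
    by (simp add: \<omega>_def exp_minus field_simps)
  have "\<exists>q\<in>\<N> smul \<tau>. \<forall>x. (SUP t\<in>{0..S}. ereal (exp (- \<omega> * t) * p (T t x))) \<le> ereal (M * q x)"
    if S: "0 \<le> S" and p: "p \<in> \<N> smul \<tau>" for S p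
  proof -
    have pc: "p \<in> continuous_seminorms smul \<tau>" and p_norm: "\<And>x. p x \<le> norm x"
      and sp: "seminorm smul p"
      using p by (auto simp: norm_dominated_seminorms_def continuous_seminorms_def)
    obtain q' where q': "q' \<in> continuous_seminorms smul \<tau>"
      and pq': "\<And>t x. 0 \<le> t \<Longrightarrow> t \<le> S \<Longrightarrow> p (T t x) \<le> q' x"
      using locally_equicontinuousE[OF assms(3) S pc] by blast
    define f where "f t x = exp (- \<omega> * t) * p (T t x)" for t x
    \<comment> \<open>This supremum is real-valued: the index set is nonempty because
      \<open>S\<close> is nonnegative, and \<open>f_q'\<close> below bounds the family at each
      \<open>x\<close>.\<close>
    define g where "g x = (SUP t\<in>{0..S}. f t x)" for x
    have f_norm: "f t x \<le> M * norm x" if "t \<in> {0..S}" for t x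
      using order_trans[OF mult_left_mono[OF p_norm[of "T t x"]] growth[of t x]] that
      by (simp add: f_def)
    \<comment> \<open>The damping factor is at most 1 because \<open>\<omega>\<close> is
      nonnegative, so the equicontinuity bound \<open>q'\<close> survives.\<close>
    have f_q': "f t x \<le> q' x" if "t \<in> {0..S}" for t x
    proof -
      have "f t x \<le> 1 * p (T t x)"
        unfolding f_def using that \<omega> seminorm_nonneg[OF sp] by (intro mult_right_mono) auto
      also have "\<dots> \<le> q' x" using pq' that by simp
      finally show ?thesis .
    qed
    have f_g: "f t x \<le> g x" if "t \<in> {0..S}" for t x
      unfolding g_def using f_q' that by (intro cSUP_upper bdd_aboveI2[of _ _ "q' x"])
    have g_le: "g x \<le> b" if "\<And>t. t \<in> {0..S} \<Longrightarrow> f t x \<le> b" for x b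
      unfolding g_def using S that by (intro cSUP_least) auto
    have f_smul: "f t (smul c x) = norm c * f t x" if "t \<in> {0..S}" for t c x
      using that by (simp add: f_def scale seminorm_smul[OF sp])
    have g_nonneg: "0 \<le> g x" for x
      using f_g[of 0 x] S seminorm_nonneg[OF sp, of "T 0 x"] by (simp add: f_def)
    have g_smul: "g (smul c x) \<le> norm c * g x" for c x
      by (rule g_le) (auto simp: f_smul intro!: mult_left_mono f_g)
    have g_add: "g (x + y) \<le> g x + g y" for x y
    proof (rule g_le)
      fix t assume t: "t \<in> {0..S}"
      have "f t (x + y) \<le> f t x + f t y"
        using t seminorm_triangle[OF sp, of "T t x" "T t y"]
        by (simp add: f_def add distrib_left[symmetric])
      also have "\<dots> \<le> g x + g y" using t by (intro add_mono f_g)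
      finally show "f t (x + y) \<le> g x + g y" .
    qed
    have "seminorm smul (\<lambda>x. g x / M)"
      using M g_nonneg divide_right_mono[OF g_add, of M] divide_right_mono[OF g_smul, of M]
      by (intro seminormI) (simp_all add: add_divide_distrib)
    \<comment> \<open>Continuity for \<open>\<tau>\<close> has to come from \<open>q'\<close>, since
      the norm need not be \<open>\<tau>\<close>-continuous; the bound \<open>f_norm\<close> serves
      only for membership in \<open>\<N> smul \<tau>\<close>.\<close>
    moreover have "g x / M \<le> q' x" for x
    proof -
      have "g x / M \<le> g x / 1" using M g_nonneg by (intro divide_left_mono) auto
      also have "g x / 1 \<le> q' x" using g_le[OF f_q'] by simp
      finally show ?thesis .
    qed
    ultimately have "(\<lambda>x. g x / M) \<in> continuous_seminorms smul \<tau>"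
      by (rule continuous_seminorm_dominated[OF _ q'])
    moreover have "g x / M \<le> norm x" for x
      using g_le[OF f_norm, of x] M by (simp add: field_simps)
    ultimately have "(\<lambda>x. g x / M) \<in> \<N> smul \<tau>"
      by (simp add: norm_dominated_seminorms_def)
    moreover have "(SUP t\<in>{0..S}. ereal (exp (- \<omega> * t) * p (T t x))) \<le> ereal (M * (g x / M))" for x
      using M f_g[of _ x] by (intro SUP_least) (simp add: f_def)
    ultimately show ?thesis by (intro bexI[of _ "\<lambda>x. g x / M"] allI)
  qed
  with M show ?thesis by blast
qed

end
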